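(* Let $(D,\{\prec_x,\succ_x\}_{x\in X})$ be a matching dendriform algebra. Equip $D\otimes\mathbb K[X]$ with the associative multiplication $(a\otimes x)\bullet(b\otimes y)=(a\prec_yb)\otimes x+(a\succ_xb)\otimes y$, and $D$ with the $(D\otimes\mathbb K[X])$-bimodule structure $(a\otimes x)\cdot_Db=a\succ_xb$ and $b\cdot_D(a\otimes x)=b\prec_xa$, for $a,b\in D$, $x,y\in X$. Then the triple $(D\otimes\mathbb K[X],D,\{\mathrm{id}_x\}_{x\in X})$ is a matching relative Rota-Baxter algebra, where $\mathrm{id}_x:D\to D\otimes\mathbb K[X]$ is given by $\mathrm{id}_x(a)=a\otimes x$ for $x\in X$. Moreover, the induced matching dendriform algebra structure on $D$ coincides with the given one.
   Context: $\mathbb K$ is a commutative unital ring with $\mathrm{char}\,\mathbb K\neq 2$; all modules, linear maps and tensor products are over $\mathbb K$; $X$ is a nonempty set; $\mathbb K[X]$ is the free $\mathbb K$-module with basis $X$. A matching dendriform algebra is a $\mathbb K$-module $D$ with linear maps $\prec_x,\succ_x:D\otimes D\to D$ $(x\in X)$ such that for all $a,b,c\in D$, $x,y\in X$: $(a\prec_xb)\prec_yc=a\prec_x(b\prec_yc)+a\prec_y(b\succ_xc)$; $(a\succ_xb)\prec_yc=a\succ_x(b\prec_yc)$; $(a\prec_yb)\succ_xc+(a\succ_xb)\succ_yc=a\succ_x(b\succ_yc)$. A matching relative Rota-Baxter algebra is a triple $(A,M,\{P_x\}_{x\in X})$ of an associative algebra $A$ (product $\cdot$), an $A$-bimodule $M$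 (actions $\cdot_M$) and linear maps $P_x:M\to A$ such that $P_x(u)\cdot P_y(v)=P_x(u\cdot_M P_y(v))+P_y(P_x(u)\cdot_M v)$ for all $u,v\in M$, $x,y\in X$. The matching dendriform algebra structure it induces on $M$ is $u\prec_xv=u\cdot_MP_x(v)$, $u\succ_xv=P_x(u)\cdot_Mv$. *)

theory Defs
  imports Complex_Main "HOL-Library.Poly_Mapping"
begin

text \<open>Linear maps out of a tensor product \<open>M \<otimes> N\<close> are written as bilinear maps.\<close>

definition bilinear_map ::
  "('k::comm_ring_1 \<Rightarrow> 'm::ab_group_add \<Rightarrow> 'm) \<Rightarrow> ('k \<Rightarrow> 'n::ab_group_add \<Rightarrow> 'n) \<Rightarrow>
   ('k \<Rightarrow> 'p::ab_group_add \<Rightarrow> 'p) \<Rightarrow> ('m \<Rightarrow> 'n \<Rightarrow> 'p) \<Rightarrow> bool"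
  where "bilinear_map sM sN sP f \<longleftrightarrow>
    (\<forall>u. module_hom sN sP (f u)) \<and> (\<forall>v. module_hom sM sP (\<lambda>u. f u v))"

text \<open>The free module on a type \<open>'s\<close> is \<open>'s \<Rightarrow>\<^sub>0 'k\<close>, with the following scalar
  multiplication and basis.\<close>

definition free_scale :: "'k::comm_ring_1 \<Rightarrow> ('s \<Rightarrow>\<^sub>0 'k) \<Rightarrow> ('s \<Rightarrow>\<^sub>0 'k)"
  where "free_scale c p = Poly_Mapping.map ((*) c) p"

definition free_basis :: "'s \<Rightarrow> ('s \<Rightarrow>\<^sub>0 'k::comm_ring_1)"
  where "free_basis s = Poly_Mapping.single s 1"

definition free_lift ::
  "('k::comm_ring_1 \<Rightarrow> 'p::ab_group_add \<Rightarrow> 'p) \<Rightarrow> ('s \<Rightarrow> 'p) \<Rightarrow> ('s \<Rightarrow>\<^sub>0 'k) \<Rightarrow> 'p"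
  where "free_lift sP g p = (\<Sum>s\<in>Poly_Mapping.keys p. sP (Poly_Mapping.lookup p s) (g s))"

definition tensor_relations ::
  "('k::comm_ring_1 \<Rightarrow> 'm::ab_group_add \<Rightarrow> 'm) \<Rightarrow> ('k \<Rightarrow> 'n::ab_group_add \<Rightarrow> 'n) \<Rightarrow>
   ('m \<times> 'n \<Rightarrow>\<^sub>0 'k) set"
  where "tensor_relations sM sN =
      {free_basis (u + u', v) - free_basis (u, v) - free_basis (u', v) | u u' v. True}
    \<union> {free_basis (u, v + v') - free_basis (u, v) - free_basis (u, v') | u v v'. True}
    \<union> {free_basis (sM c u, v) - free_scale c (free_basis (u, v)) | c u v. True}
    \<union> {free_basis (u, sN c v) - free_scale c (free_basis (u, v)) | c u v. True}"

text \<open>A HOL type cannot depend on the scalar multiplications of \<open>M\<close> and \<open>N\<close>, so the tensor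
  product is specified up to its canonical isomorphism: \<open>T\<close> with the map \<open>(u, v) \<mapsto> u \<otimes> v\<close>
  is a tensor product of \<open>M\<close> and \<open>N\<close> if the induced map from the free module on
  \<open>M \<times> N\<close> to \<open>T\<close> is surjective and its kernel is the submodule generated by the
  bilinearity relations, that is, if it identifies \<open>T\<close> with the usual quotient.\<close>

locale tensor_product =
  M: module scaleM + N: module scaleN + T: module scaleT
  for scaleM :: "'k::comm_ring_1 \<Rightarrow> 'm::ab_group_add \<Rightarrow> 'm"
    and scaleN :: "'k \<Rightarrow> 'n::ab_group_add \<Rightarrow> 'n"
    and scaleT :: "'k \<Rightarrow> 't::ab_group_add \<Rightarrow> 't" +
  fixes tensor :: "'m \<Rightarrow> 'n \<Rightarrow> 't"
  assumes surj: "surj (free_lift scaleT (\<lambda>(u, v). tensor u v))"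
    and kernel: "{p. free_lift scaleT (\<lambda>(u, v). tensor u v) p = 0} =
      module.span free_scale (tensor_relations scaleM scaleN)"

lemma lookup_free_scale [simp]: 
  "Poly_Mapping.lookup (free_scale c p) s = c * Poly_Mapping.lookup p s"
  by (simp add: free_scale_def map.rep_eq when_def)

lemma module_free_scale: "module (free_scale :: 'k::comm_ring_1 \<Rightarrow> ('s \<Rightarrow>\<^sub>0 'k) \<Rightarrow> _)"
  by unfold_locales (auto intro!: poly_mapping_eqI simp: lookup_add algebra_simps)

lemma lookup_free_basis: "Poly_Mapping.lookup (free_basis s) t = (if s = t then 1 else 0)"
  by (simp add: free_basis_def lookup_single when_def)

lemma single_eq: "Poly_Mapping.single s c = free_scale c (free_basis s)"
  by (rule poly_mapping_eqI) (simp add: lookup_single lookup_free_basis when_def)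

lemma poly_mapping_decomp:
  fixes p :: "'s \<Rightarrow>\<^sub>0 'b::comm_monoid_add"
  assumes "finite S" "Poly_Mapping.keys p \<subseteq> S"
  shows "p = (\<Sum>s\<in>S. Poly_Mapping.single s (Poly_Mapping.lookup p s))"
proof (rule poly_mapping_eqI)
  fix k
  have "Poly_Mapping.lookup (\<Sum>s\<in>S. Poly_Mapping.single s (Poly_Mapping.lookup p s)) k
      = (\<Sum>s\<in>S. if s = k then Poly_Mapping.lookup p s else 0)"
    by (simp add: lookup_sum lookup_single when_def)
  also have "\<dots> = Poly_Mapping.lookup p k"
    using assms by (auto simp: in_keys_iff)
  finally show "Poly_Mapping.lookup p k =
      Poly_Mapping.lookup (\<Sum>s\<in>S. Poly_Mapping.single s (Poly_Mapping.lookup p s)) k" ..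
qed

context module begin

lemma free_lift_superset:
  assumes "finite S" "Poly_Mapping.keys p \<subseteq> S"
  shows "free_lift scale g p = (\<Sum>s\<in>S. scale (Poly_Mapping.lookup p s) (g s))"
  unfolding free_lift_def
  by (rule sum.mono_neutral_left) (use assms in \<open>auto simp: in_keys_iff\<close>)

lemma module_hom_free_lift: "module_hom free_scale scale (free_lift scale g)"
proof -
  interpret F: module "free_scale :: 'a \<Rightarrow> ('s \<Rightarrow>\<^sub>0 'a) \<Rightarrow> _" by (rule module_free_scale)
  show ?thesis
  proof unfold_locales
    fix p q :: "'c \<Rightarrow>\<^sub>0 'a"
    let ?S = "Poly_Mapping.keys p \<union> Poly_Mapping.keys q"
    have "free_lift scale g (p + q) = (\<Sum>s\<in>?S. scale (Poly_Mapping.lookup (p + q) s) (g s))"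
      by (rule free_lift_superset) (auto simp: keys_add)
    moreover have "free_lift scale g p = (\<Sum>s\<in>?S. scale (Poly_Mapping.lookup p s) (g s))"
      by (rule free_lift_superset) auto
    moreover have "free_lift scale g q = (\<Sum>s\<in>?S. scale (Poly_Mapping.lookup q s) (g s))"
      by (rule free_lift_superset) auto
    ultimately show "free_lift scale g (p + q) = free_lift scale g p + free_lift scale g q"
      by (simp add: lookup_add scale_left_distrib sum.distrib)
  next
    fix c and p :: "'c \<Rightarrow>\<^sub>0 'a"
    have "free_lift scale g (free_scale c p)
        = (\<Sum>s\<in>Poly_Mapping.keys p. scale (Poly_Mapping.lookup (free_scale c p) s) (g s))"
      by (rule free_lift_superset) (auto simp: in_keys_iff)
    then show "free_lift scale g (free_scale c p) = scale c (free_lift scale g p)"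
      by (simp add: free_lift_def scale_sum_right)
  qed
qed

lemma free_lift_basis: "free_lift scale g (free_basis s) = g s"
proof -
  have "free_lift scale g (free_basis s)
      = (\<Sum>t\<in>{s}. scale (Poly_Mapping.lookup (free_basis s) t) (g t))"
    by (rule free_lift_superset) (auto simp: free_basis_def split: if_splits)
  then show ?thesis by (simp add: lookup_free_basis)
qed

text \<open>Tensor products in the above sense exist: the finitely supported functions from \<open>'x\<close>
  to \<open>M\<close> form a tensor product of \<open>M\<close> and the free module on \<open>'x\<close>.\<close>

lemma tensor_product_exists:
  "tensor_product scale free_scale (\<lambda>c. Poly_Mapping.map (scale c))
     (\<lambda>a p. Poly_Mapping.map (\<lambda>c. scale c a) (p :: 'x \<Rightarrow>\<^sub>0 'a))"
  (is "tensor_product _ _ ?sT ?t")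
proof -
  interpret N: module "free_scale :: 'a \<Rightarrow> ('x \<Rightarrow>\<^sub>0 'a) \<Rightarrow> _" by (rule module_free_scale)
  interpret F: module "free_scale :: 'a \<Rightarrow> ('b \<times> ('x \<Rightarrow>\<^sub>0 'a) \<Rightarrow>\<^sub>0 'a) \<Rightarrow> _"
    by (rule module_free_scale)
  have lsT [simp]: "Poly_Mapping.lookup (?sT c q) x = scale c (Poly_Mapping.lookup q x)"
    for c x and q :: "'x \<Rightarrow>\<^sub>0 'b"
    by (simp add: map.rep_eq when_def)
  have lt [simp]: "Poly_Mapping.lookup (?t a p) x = scale (Poly_Mapping.lookup p x) a"
    for a x and p :: "'x \<Rightarrow>\<^sub>0 'a"
    by (simp add: map.rep_eq when_def)
  interpret T: module "?sT :: 'a \<Rightarrow> ('x \<Rightarrow>\<^sub>0 'b) \<Rightarrow> _"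
    by unfold_locales (auto intro!: poly_mapping_eqI simp: lookup_add algebra_simps)
  let ?L = "free_lift ?sT (\<lambda>(u, v). ?t u v)"
  interpret L: module_hom free_scale ?sT ?L by (rule T.module_hom_free_lift)
  have L_basis: "?L (free_basis (u, v)) = ?t u v" for u v
    by (simp add: T.free_lift_basis)
  let ?R = "F.span (tensor_relations scale free_scale)"
  define cong where "cong p q \<longleftrightarrow> p - q \<in> ?R" for p q
  have cong_refl: "cong p p" for p by (simp add: cong_def F.span_zero)
  have cong_sym: "cong q p" if "cong p q" for p q
    using F.span_neg[of "p - q"] that by (simp add: cong_def)
  have cong_trans [trans]: "cong p r" if "cong p q" "cong q r" for p q r
    using F.span_add[of "p - q" _ "q - r"] that by (simp add: cong_def)
  have cong_add: "cong (p + p') (q + q')" if "cong p q" "cong p' q'" for p q p' q'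
    using F.span_add[of "p - q" _ "p' - q'"] that by (simp add: cong_def algebra_simps)
  have cong_scale: "cong (free_scale c p) (free_scale c q)" if "cong p q" for c p q
    using F.span_scale[of "p - q" _ c] that by (simp add: cong_def F.scale_right_diff_distrib)
  have r1: "cong (free_basis (u + u', v)) (free_basis (u, v) + free_basis (u', v))" for u u' v
    unfolding cong_def tensor_relations_def diff_diff_eq[symmetric] by (rule F.span_base) blast
  have r2: "cong (free_basis (u, v + v')) (free_basis (u, v) + free_basis (u, v'))" for u v v'
    unfolding cong_def tensor_relations_def diff_diff_eq[symmetric] by (rule F.span_base) blast
  have r3: "cong (free_basis (scale c u, v)) (free_scale c (free_basis (u, v)))" for c u v
    unfolding cong_def tensor_relations_def by (rule F.span_base) blast
  have r4: "cong (free_basis (u, free_scale c v)) (free_scale c (free_basis (u, v)))" for c u v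
    unfolding cong_def tensor_relations_def by (rule F.span_base) blast
  have b0: "cong (free_basis (0, v)) 0" for v using r3[of 0 0 v] by simp
  have b0': "cong (free_basis (u, 0)) 0" for u using r4[of u 0 0] by simp
  define \<sigma> :: "('x \<Rightarrow>\<^sub>0 'b) \<Rightarrow> ('b \<times> ('x \<Rightarrow>\<^sub>0 'a) \<Rightarrow>\<^sub>0 'a)" where
    "\<sigma> q = (\<Sum>x\<in>Poly_Mapping.keys q. free_basis (Poly_Mapping.lookup q x, free_basis x))"
    for q
  have cong_sum: "cong (sum f S) (sum g S)" if "\<And>x. x \<in> S \<Longrightarrow> cong (f x) (g x)" for f g and S :: "'x set"
    using that by (induct S rule: infinite_finite_induct) (auto intro: cong_refl cong_add)
  have \<sigma>: "cong (\<sigma> q) (\<Sum>x\<in>S. free_basis (Poly_Mapping.lookup q x, free_basis x))"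
    if S: "finite S" "Poly_Mapping.keys q \<subseteq> S" for q S
  proof -
    have "\<sigma> q = (\<Sum>x\<in>S. if x \<in> Poly_Mapping.keys q then free_basis (Poly_Mapping.lookup q x, free_basis x) else 0)"
      unfolding \<sigma>_def using S by (simp add: sum.inter_restrict[symmetric] Int_absorb1)
    moreover have "cong \<dots> (\<Sum>x\<in>S. free_basis (Poly_Mapping.lookup q x, free_basis x))"
      by (rule cong_sum) (auto simp: in_keys_iff intro: cong_refl cong_sym[OF b0])
    ultimately show ?thesis by simp
  qed
  have \<sigma>_add: "cong (\<sigma> (p + q)) (\<sigma> p + \<sigma> q)" for p q
  proof -
    let ?S = "Poly_Mapping.keys p \<union> Poly_Mapping.keys q"
    have "cong (\<sigma> (p + q)) (\<Sum>x\<in>?S. free_basis (Poly_Mapping.lookup (p + q) x, free_basis x))"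
      by (rule \<sigma>) (auto simp: keys_add)
    also have "cong \<dots> (\<Sum>x\<in>?S. free_basis (Poly_Mapping.lookup p x, free_basis x)
        + free_basis (Poly_Mapping.lookup q x, free_basis x))"
      by (rule cong_sum) (simp add: lookup_add r1)
    also have "cong \<dots> (\<sigma> p + \<sigma> q)"
      unfolding sum.distrib by (intro cong_add cong_sym[OF \<sigma>]) auto
    finally show ?thesis .
  qed
  have \<sigma>_scale: "cong (\<sigma> (?sT c q)) (free_scale c (\<sigma> q))" for c q
  proof -
    let ?S = "Poly_Mapping.keys q"
    have "cong (\<sigma> (?sT c q)) (\<Sum>x\<in>?S. free_basis (Poly_Mapping.lookup (?sT c q) x, free_basis x))"
      by (rule \<sigma>) (auto simp: in_keys_iff)
    also have "cong \<dots> (\<Sum>x\<in>?S. free_scale c (free_basis (Poly_Mapping.lookup q x, free_basis x)))"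
      by (rule cong_sum) (simp add: r3)
    also have "\<dots> = free_scale c (\<sigma> q)" by (simp add: \<sigma>_def F.scale_sum_right)
    finally show ?thesis .
  qed
  have basis_sum: "cong (free_basis (u, sum f S)) (\<Sum>x\<in>S. free_basis (u, f x))"
    if "finite S" for u f and S :: "'x set"
    using that by (induct S) (auto intro: b0' cong_trans[OF r2] cong_add cong_refl)
  have pure: "cong (free_basis (u, v)) (\<sigma> (?t u v))" for u and v :: "'x \<Rightarrow>\<^sub>0 'a"
  proof -
    let ?S = "Poly_Mapping.keys v"
    have v: "v = (\<Sum>x\<in>?S. free_scale (Poly_Mapping.lookup v x) (free_basis x))"
      unfolding single_eq[symmetric] by (rule poly_mapping_decomp) auto
    have "cong (free_basis (u, v))
        (\<Sum>x\<in>?S. free_basis (u, free_scale (Poly_Mapping.lookup v x) (free_basis x)))"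
      by (subst v) (rule basis_sum, simp)
    also have "cong \<dots> (\<Sum>x\<in>?S. free_basis (scale (Poly_Mapping.lookup v x) u, free_basis x))"
      by (rule cong_sum) (rule cong_trans[OF r4 cong_sym[OF r3]])
    also have "cong \<dots> (\<sigma> (?t u v))"
      using cong_sym[OF \<sigma>[of ?S "?t u v"]] by (force simp: in_keys_iff)
    finally show ?thesis .
  qed
  have lift: "cong p (\<sigma> (?L p))" for p
  proof -
    have "cong (\<Sum>z\<in>S. free_scale (c z) (free_basis z))
        (\<sigma> (?L (\<Sum>z\<in>S. free_scale (c z) (free_basis z))))" if "finite S" for S and c :: "_ \<Rightarrow> 'a"
      using that
    proof (induct S)
      case empty
      then show ?case by (simp add: \<sigma>_def cong_refl L.zero)
    next
      case (insert z S)
      obtain u v where z: "z = (u, v)" by (cases z)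
      have "cong (free_scale (c z) (free_basis z)) (\<sigma> (?sT (c z) (?L (free_basis z))))"
        unfolding z L_basis by (rule cong_trans[OF cong_scale[OF pure] cong_sym[OF \<sigma>_scale]])
      from cong_trans[OF cong_add[OF this insert(3)] cong_sym[OF \<sigma>_add]]
      show ?case using insert(1,2) by (simp add: L.add L.scale)
    qed
    from this[of "Poly_Mapping.keys p" "Poly_Mapping.lookup p"]
    have *: "cong q (\<sigma> (?L q))"
      if "q = (\<Sum>z\<in>Poly_Mapping.keys p. free_scale (Poly_Mapping.lookup p z) (free_basis z))" for q
      using that by simp
    show ?thesis
      by (rule *) (unfold single_eq[symmetric], rule poly_mapping_decomp, auto)
  qed
  show ?thesis
  proof unfold_locales
    have "q = ?L (\<sigma> q)" for q
    proof -
      have "?L (\<sigma> q) = (\<Sum>x\<in>Poly_Mapping.keys q. ?t (Poly_Mapping.lookup q x) (free_basis x))"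
        by (simp add: \<sigma>_def L.sum L_basis)
      also have "\<dots> = (\<Sum>x\<in>Poly_Mapping.keys q. Poly_Mapping.single x (Poly_Mapping.lookup q x))"
        by (rule sum.cong) (auto intro!: poly_mapping_eqI simp: lookup_single lookup_free_basis when_def)
      also have "\<dots> = q" by (rule poly_mapping_decomp[symmetric]) auto
      finally show ?thesis by simp
    qed
    then show "surj ?L" by (metis surjI)
    have "?t (u + u') v = ?t u v + ?t u' v" for u u' and v :: "'x \<Rightarrow>\<^sub>0 'a"
      by (rule poly_mapping_eqI) (simp only: lt lookup_add, rule scale_right_distrib)
    moreover have "?t u (v + v') = ?t u v + ?t u v'" for u and v v' :: "'x \<Rightarrow>\<^sub>0 'a"
      by (rule poly_mapping_eqI) (simp only: lt lookup_add, rule scale_left_distrib)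
    moreover have "?t (scale c u) v = ?sT c (?t u v)" for c u and v :: "'x \<Rightarrow>\<^sub>0 'a"
      by (rule poly_mapping_eqI) (simp only: lt lsT, simp add: mult.commute)
    moreover have "?t u (free_scale c v) = ?sT c (?t u v)" for c u and v :: "'x \<Rightarrow>\<^sub>0 'a"
      by (rule poly_mapping_eqI) (simp only: lt lsT, simp)
    ultimately have "?L (free_basis (u + u', v) - free_basis (u, v) - free_basis (u', v)) = 0"
      and "?L (free_basis (u, v + v') - free_basis (u, v) - free_basis (u, v')) = 0"
      and "?L (free_basis (scale c u, v) - free_scale c (free_basis (u, v))) = 0"
      and "?L (free_basis (u, free_scale c v) - free_scale c (free_basis (u, v))) = 0"
      for u u' and v v' :: "'x \<Rightarrow>\<^sub>0 'a" and c
      by (simp_all only: L.diff L.scale L_basis add_diff_cancel_left' diff_self)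
    then have "tensor_relations scale free_scale \<subseteq> {p. ?L p = 0}"
      unfolding tensor_relations_def by blast
    then have "?R \<subseteq> {p. ?L p = 0}"
      by (rule F.span_minimal) (auto simp: F.subspace_def L.add L.scale L.zero)
    moreover have "p \<in> ?R" if "?L p = 0" for p
      using lift[of p] that by (simp add: cong_def \<sigma>_def)
    ultimately show "{p. ?L p = 0} = ?R" by blast
  qed
qed

end

locale matching_dendriform_algebra = module scale
  for scale :: "'k::comm_ring_1 \<Rightarrow> 'd::ab_group_add \<Rightarrow> 'd" +
  fixes prec succ :: "'x \<Rightarrow> 'd \<Rightarrow> 'd \<Rightarrow> 'd"
  assumes prec_bilinear: "bilinear_map scale scale scale (prec x)"
    and succ_bilinear: "bilinear_map scale scale scale (succ x)"
    and prec_prec: "prec y (prec x a b) c = prec x a (prec y b c) + prec y a (succ x b c)"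
    and succ_prec: "prec y (succ x a b) c = succ x a (prec y b c)"
    and succ_succ: "succ x (prec y a b) c + succ y (succ x a b) c = succ x a (succ y b c)"

text \<open>Associative algebras are not required to have a unit.\<close>

locale associative_algebra = module scale
  for scale :: "'k::comm_ring_1 \<Rightarrow> 'a::ab_group_add \<Rightarrow> 'a" +
  fixes mul :: "'a \<Rightarrow> 'a \<Rightarrow> 'a"
  assumes mult_bilinear: "bilinear_map scale scale scale mul"
    and mult_assoc: "mul (mul a b) c = mul a (mul b c)"

locale algebra_bimodule = A: associative_algebra scaleA mul + M: module scaleM
  for scaleA :: "'k::comm_ring_1 \<Rightarrow> 'a::ab_group_add \<Rightarrow> 'a"
    and mul :: "'a \<Rightarrow> 'a \<Rightarrow> 'a"
    and scaleM :: "'k \<Rightarrow> 'm::ab_group_add \<Rightarrow> 'm" +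
  fixes lact :: "'a \<Rightarrow> 'm \<Rightarrow> 'm"
    and ract :: "'m \<Rightarrow> 'a \<Rightarrow> 'm"
  assumes lact_bilinear: "bilinear_map scaleA scaleM scaleM lact"
    and ract_bilinear: "bilinear_map scaleM scaleA scaleM ract"
    and lact_lact: "lact a (lact b u) = lact (mul a b) u"
    and ract_ract: "ract (ract u a) b = ract u (mul a b)"
    and lact_ract: "ract (lact a u) b = lact a (ract u b)"

locale matching_relative_rota_baxter_algebra =
  algebra_bimodule scaleA mul scaleM lact ract
  for scaleA :: "'k::comm_ring_1 \<Rightarrow> 'a::ab_group_add \<Rightarrow> 'a"
    and mul :: "'a \<Rightarrow> 'a \<Rightarrow> 'a"
    and scaleM :: "'k \<Rightarrow> 'm::ab_group_add \<Rightarrow> 'm"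
    and lact :: "'a \<Rightarrow> 'm \<Rightarrow> 'm"
    and ract :: "'m \<Rightarrow> 'a \<Rightarrow> 'm" +
  fixes P :: "'x \<Rightarrow> 'm \<Rightarrow> 'a"
  assumes P_linear: "module_hom scaleM scaleA (P x)"
    and rota_baxter:
      "mul (P x u) (P y v) = P x (ract u (P y v)) + P y (lact (P x u) v)"

definition induced_prec :: "('m \<Rightarrow> 'a \<Rightarrow> 'm) \<Rightarrow> ('x \<Rightarrow> 'm \<Rightarrow> 'a) \<Rightarrow> 'x \<Rightarrow> 'm \<Rightarrow> 'm \<Rightarrow> 'm"
  where "induced_prec ract P x u v = ract u (P x v)"

definition induced_succ :: "('a \<Rightarrow> 'm \<Rightarrow> 'm) \<Rightarrow> ('x \<Rightarrow> 'm \<Rightarrow> 'a) \<Rightarrow> 'x \<Rightarrow> 'm \<Rightarrow> 'm \<Rightarrow> 'm"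
  where "induced_succ lact P x u v = lact (P x u) v"

text \<open>The multiplication on \<open>D \<otimes> \<bbbK>[X]\<close> and its actions on \<open>D\<close> are the bilinear
  maps with prescribed values on the tensors \<open>a \<otimes> x\<close> of an element of \<open>D\<close> and a
  basis element.\<close>

definition basis_embedding ::
  "('d \<Rightarrow> ('x \<Rightarrow>\<^sub>0 'k::comm_ring_1) \<Rightarrow> 't) \<Rightarrow> 'x \<Rightarrow> 'd \<Rightarrow> 't"
  where "basis_embedding tensor x a = tensor a (free_basis x)"

definition is_dendriform_mult ::
  "('k::comm_ring_1 \<Rightarrow> 't::ab_group_add \<Rightarrow> 't) \<Rightarrow> ('d \<Rightarrow> ('x \<Rightarrow>\<^sub>0 'k) \<Rightarrow> 't) \<Rightarrow>
   ('x \<Rightarrow> 'd \<Rightarrow> 'd \<Rightarrow> 'd) \<Rightarrow> ('x \<Rightarrow> 'd \<Rightarrow> 'd \<Rightarrow> 'd) \<Rightarrow> ('t \<Rightarrow> 't \<Rightarrow> 't) \<Rightarrow> bool"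
  where "is_dendriform_mult scaleT tensor prec succ mul \<longleftrightarrow>
    bilinear_map scaleT scaleT scaleT mul \<and>
    (\<forall>a b x y. mul (tensor a (free_basis x)) (tensor b (free_basis y)) =
      tensor (prec y a b) (free_basis x) + tensor (succ x a b) (free_basis y))"

definition is_dendriform_lact ::
  "('k::comm_ring_1 \<Rightarrow> 'd::ab_group_add \<Rightarrow> 'd) \<Rightarrow> ('k \<Rightarrow> 't::ab_group_add \<Rightarrow> 't) \<Rightarrow>
   ('d \<Rightarrow> ('x \<Rightarrow>\<^sub>0 'k) \<Rightarrow> 't) \<Rightarrow> ('x \<Rightarrow> 'd \<Rightarrow> 'd \<Rightarrow> 'd) \<Rightarrow> ('t \<Rightarrow> 'd \<Rightarrow> 'd) \<Rightarrow> bool"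
  where "is_dendriform_lact scaleD scaleT tensor succ lact \<longleftrightarrow>
    bilinear_map scaleT scaleD scaleD lact \<and>
    (\<forall>a b x. lact (tensor a (free_basis x)) b = succ x a b)"

definition is_dendriform_ract ::
  "('k::comm_ring_1 \<Rightarrow> 'd::ab_group_add \<Rightarrow> 'd) \<Rightarrow> ('k \<Rightarrow> 't::ab_group_add \<Rightarrow> 't) \<Rightarrow>
   ('d \<Rightarrow> ('x \<Rightarrow>\<^sub>0 'k) \<Rightarrow> 't) \<Rightarrow> ('x \<Rightarrow> 'd \<Rightarrow> 'd \<Rightarrow> 'd) \<Rightarrow> ('d \<Rightarrow> 't \<Rightarrow> 'd) \<Rightarrow> bool"
  where "is_dendriform_ract scaleD scaleT tensor prec ract \<longleftrightarrow>
    bilinear_map scaleD scaleT scaleD ract \<and>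
    (\<forall>a b x. ract b (tensor a (free_basis x)) = prec x b a)"

end

theory Submission
  imports Defs
begin

text \<open>
  Every element of \<open>D \<otimes> \<bbbK>[X]\<close> is a sum of tensors \<open>a \<otimes> x\<close> with \<open>a\<close> in \<open>D\<close> and \<open>x\<close> a basis
  element; scalars can be absorbed into \<open>a\<close> (\<open>tensor_basis_induct\<close>). So additive maps that agree
  on these tensors are equal, and multiadditive identities need to be checked on them only.
  Conversely, prescribing values on the \<open>a \<otimes> x\<close> linearly in \<open>a\<close> always defines a linear map on
  \<open>D \<otimes> \<bbbK>[X]\<close>, also with a linear parameter (\<open>bilinear_extension\<close>). This makes the two
  actions and, after a second use for the other factor, the multiplication exist uniquely.

  On tensors \<open>a \<otimes> x\<close> everything is a reading of the dendriform axioms. Associativity of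
  \<open>\<bullet>\<close> compares the components in front of the three basis elements of
  \<open>(a \<otimes> x) \<bullet> (b \<otimes> y) \<bullet> (c \<otimes> z)\<close>: at \<open>x\<close>, \<open>y\<close>, \<open>z\<close> they are exactly the first,
  second and third axiom. The same three axioms are the compatibilities of the right action with
  \<open>\<bullet>\<close>, of the two actions with each other, and of the left action with \<open>\<bullet>\<close>. The
  Rota-Baxter identity for \<open>id\<^sub>x\<close> is the definition of \<open>\<bullet>\<close>, and the induced operations are the
  actions evaluated at \<open>a \<otimes> x\<close>.
\<close>

section \<open>The universal property of the tensor product\<close>

lemma bilinear_map_iff:
  "bilinear_map sM sN sP f \<longleftrightarrow> module sM \<and> module sN \<and> module sP \<and>
    (\<forall>u u' v. f (u + u') v = f u v + f u' v) \<and> (\<forall>c u v. f (sM c u) v = sP c (f u v)) \<and>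
    (\<forall>u v v'. f u (v + v') = f u v + f u v') \<and> (\<forall>c u v. f u (sN c v) = sP c (f u v))"
  unfolding bilinear_map_def module_hom_iff by blast

lemma bilinear_map_flip:
  "bilinear_map sM sN sP f \<Longrightarrow> bilinear_map sN sM sP (\<lambda>v u. f u v)"
  unfolding bilinear_map_def by blast

context tensor_product
begin

text \<open>The bilinearity relations lie in the kernel of the presentation of the tensor product.\<close>

lemma bilinear_tensor: "bilinear_map scaleM scaleN scaleT tensor"
proof -
  let ?L = "free_lift scaleT (\<lambda>(u, v). tensor u v)"
  interpret F: module "free_scale :: 'k \<Rightarrow> ('m \<times> 'n \<Rightarrow>\<^sub>0 'k) \<Rightarrow> _" by (rule module_free_scale)
  interpret L: module_hom free_scale scaleT ?L by (rule T.module_hom_free_lift)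
  have basis: "?L (free_basis (u, v)) = tensor u v" for u v
    by (simp add: T.free_lift_basis)
  have relation: "?L p = 0" if "p \<in> tensor_relations scaleM scaleN" for p
    using F.span_base[OF that] kernel by blast
  note LE = L.diff L.scale basis
  show ?thesis
    unfolding bilinear_map_iff
  proof (intro conjI allI)
    show "tensor (u + u') v = tensor u v + tensor u' v" for u u' v
    proof -
      have "?L (free_basis (u + u', v) - free_basis (u, v) - free_basis (u', v)) = 0"
        by (rule relation) (unfold tensor_relations_def, blast)
      then show ?thesis by (simp only: LE) (simp add: algebra_simps)
    qed
    show "tensor u (v + v') = tensor u v + tensor u v'" for u v v'
    proof -
      have "?L (free_basis (u, v + v') - free_basis (u, v) - free_basis (u, v')) = 0"
        by (rule relation) (unfold tensor_relations_def, blast)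
      then show ?thesis by (simp only: LE) (simp add: algebra_simps)
    qed
    show "tensor (scaleM c u) v = scaleT c (tensor u v)" for c u v
    proof -
      have "?L (free_basis (scaleM c u, v) - free_scale c (free_basis (u, v))) = 0"
        by (rule relation) (unfold tensor_relations_def, blast)
      then show ?thesis by (simp only: LE) simp
    qed
    show "tensor u (scaleN c v) = scaleT c (tensor u v)" for c u v
    proof -
      have "?L (free_basis (u, scaleN c v) - free_scale c (free_basis (u, v))) = 0"
        by (rule relation) (unfold tensor_relations_def, blast)
      then show ?thesis by (simp only: LE) simp
    qed
  qed (rule M.module_axioms N.module_axioms T.module_axioms)+
qed

text \<open>The universal property: the linear extension of a bilinear map to the free module on
  \<open>M \<times> N\<close> kills the bilinearity relations, hence factors through the presentation.\<close>

lemma universal_property: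
  assumes f: "bilinear_map scaleM scaleN scaleP f"
  obtains h where "module_hom scaleT scaleP h" and "\<And>u v. h (tensor u v) = f u v"
proof -
  let ?L = "free_lift scaleT (\<lambda>(u, v). tensor u v)"
  let ?K = "free_lift scaleP (\<lambda>(u, v). f u v)"
  interpret F: module "free_scale :: 'k \<Rightarrow> ('m \<times> 'n \<Rightarrow>\<^sub>0 'k) \<Rightarrow> _" by (rule module_free_scale)
  interpret P: module scaleP using f by (simp add: bilinear_map_iff)
  interpret L: module_hom free_scale scaleT ?L by (rule T.module_hom_free_lift)
  interpret K: module_hom free_scale scaleP ?K by (rule P.module_hom_free_lift)
  have L_basis: "?L (free_basis (u, v)) = tensor u v" for u v
    by (simp add: T.free_lift_basis)
  have K_basis: "?K (free_basis (u, v)) = f u v" for u v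
    by (simp add: P.free_lift_basis)
  have "tensor_relations scaleM scaleN \<subseteq> {p. ?K p = 0}"
    using f unfolding tensor_relations_def bilinear_map_iff
    by (auto simp only: K.diff K.scale K_basis mem_Collect_eq Un_iff) auto
  then have "F.span (tensor_relations scaleM scaleN) \<subseteq> {p. ?K p = 0}"
    by (rule F.span_minimal) (auto simp: F.subspace_def K.add K.scale K.zero)
  then have "?K p = 0" if "?L p = 0" for p
    using that kernel by blast
  then have well_defined: "?K p = ?K q" if "?L p = ?L q" for p q
    using that L.diff[of p q] K.diff[of p q] by simp
  define h where "h t = ?K (inv ?L t)" for t
  have hL: "h (?L p) = ?K p" for p
    unfolding h_def by (rule well_defined) (rule surj_f_inv_f[OF surj])
  have "module_hom scaleT scaleP h"
    unfolding module_hom_iff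
  proof (intro conjI allI)
    show "h (s + t) = h s + h t" for s t
      by (metis K.add L.add hL surjD[OF surj])
    show "h (scaleT c t) = scaleP c (h t)" for c t
      by (metis K.scale L.scale hL surjD[OF surj])
  qed (rule T.module_axioms P.module_axioms)+
  moreover have "h (tensor u v) = f u v" for u v
    by (metis hL L_basis K_basis)
  ultimately show thesis by (rule that)
qed

end

section \<open>Tensor products with a free module\<close>

locale tensor_with_free =
  tensor_product scaleM "free_scale :: 'k \<Rightarrow> ('x \<Rightarrow>\<^sub>0 'k) \<Rightarrow> _" scaleT tensor
  for scaleM :: "'k::comm_ring_1 \<Rightarrow> 'm::ab_group_add \<Rightarrow> 'm"
    and scaleT :: "'k \<Rightarrow> 't::ab_group_add \<Rightarrow> 't"
    and tensor :: "'m \<Rightarrow> ('x \<Rightarrow>\<^sub>0 'k) \<Rightarrow> 't"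
begin

lemma
  shows tensor_add_left: "tensor (a + b) p = tensor a p + tensor b p"
    and tensor_scale_left: "tensor (scaleM c a) p = scaleT c (tensor a p)"
    and tensor_scale_right: "tensor a (free_scale c p) = scaleT c (tensor a p)"
  using bilinear_tensor unfolding bilinear_map_iff by blast+

text \<open>Closure under addition suffices because \<open>c (a \<otimes> x) = (c a) \<otimes> x\<close> and
  \<open>0 = 0 \<otimes> x\<close> for any \<open>x\<close>.\<close>

lemma tensor_basis_induct [case_names basis add]:
  assumes basis: "\<And>a x. Q (tensor a (free_basis x))"
    and add: "\<And>s t. Q s \<Longrightarrow> Q t \<Longrightarrow> Q (s + t)"
  shows "Q t"
proof -
  have "tensor 0 p = 0" for p
    using tensor_scale_left[of 0 0 p] by simp
  then have zero: "Q 0" by (metis basis)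
  have sum: "Q (sum f S)" if "\<And>i. i \<in> S \<Longrightarrow> Q (f i)" for f and S :: "'i set"
    using that by (induct S rule: infinite_finite_induct) (auto intro: zero add)
  have pure: "Q (tensor a p)" for a p
  proof -
    have hom: "module_hom free_scale scaleT (tensor a)"
      using bilinear_tensor by (simp add: bilinear_map_def)
    let ?g = "\<lambda>x. Poly_Mapping.single x (Poly_Mapping.lookup p x)"
    have "tensor a p = tensor a (sum ?g (Poly_Mapping.keys p))"
      by (rule arg_cong[where f = "tensor a"], rule poly_mapping_decomp) auto
    also have "\<dots> = (\<Sum>x\<in>Poly_Mapping.keys p. tensor a (?g x))"
      by (rule module_hom.sum[OF hom])
    also have "\<dots> = (\<Sum>x\<in>Poly_Mapping.keys p.
        tensor (scaleM (Poly_Mapping.lookup p x) a) (free_basis x))"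
      by (simp add: single_eq tensor_scale_left tensor_scale_right)
    finally show ?thesis by (simp add: sum basis)
  qed
  obtain p where "t = free_lift scaleT (\<lambda>(u, v). tensor u v) p"
    using surj by (metis surjD)
  also have "Q \<dots>"
    unfolding free_lift_def
    by (rule sum) (auto simp: tensor_scale_left[symmetric] pure split: prod.split)
  finally show ?thesis .
qed

text \<open>The second argument is only a parameter: for each of its values the universal property
  gives a linear map on \<open>M \<otimes> \<bbbK>[X]\<close>, and linearity in the parameter follows because it holds
  on the generators \<open>a \<otimes> x\<close>.\<close>

lemma bilinear_extension:
  assumes g: "\<And>x. bilinear_map scaleM scaleQ scaleP (g x)"
  shows "\<exists>!h. bilinear_map scaleT scaleQ scaleP h \<and>
    (\<forall>a x q. h (tensor a (free_basis x)) q = g x a q)"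
proof (rule ex_ex1I)
  interpret Q: module scaleQ using g by (simp add: bilinear_map_iff)
  interpret P: module scaleP using g by (simp add: bilinear_map_iff)
  have gE: "g x (a + b) q = g x a q + g x b q" "g x (scaleM c a) q = scaleP c (g x a q)"
    "g x a (q + r) = g x a q + g x a r" "g x a (scaleQ c q) = scaleP c (g x a q)" for x a b q r c
    using g[of x] by (auto simp: bilinear_map_iff)
  have "\<exists>h. module_hom scaleT scaleP h \<and> (\<forall>a x. h (tensor a (free_basis x)) = g x a q)" for q
  proof -
    let ?f = "\<lambda>a. free_lift scaleP (\<lambda>x. g x a q)"
    have "bilinear_map scaleM free_scale scaleP ?f"
      unfolding bilinear_map_def
    proof (intro conjI allI)
      show "module_hom free_scale scaleP (?f a)" for a
        by (rule P.module_hom_free_lift)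
      show "module_hom scaleM scaleP (\<lambda>a. ?f a p)" for p
        unfolding module_hom_iff
        by (intro conjI allI M.module_axioms P.module_axioms)
          (simp_all add: free_lift_def gE P.scale_right_distrib sum.distrib P.scale_sum_right
            mult.commute)
    qed
    then obtain h where "module_hom scaleT scaleP h" and "\<And>a p. h (tensor a p) = ?f a p"
      by (rule universal_property) blast
    then show ?thesis by (auto simp: P.free_lift_basis)
  qed
  then obtain h where h: "\<And>q. module_hom scaleT scaleP (h q)"
    and h_basis: "\<And>q a x. h q (tensor a (free_basis x)) = g x a q"
    by metis
  have h_add: "h q (s + t) = h q s + h q t" and h_scale: "h q (scaleT c t) = scaleP c (h q t)"
    for q s t c
    using h[of q] by (auto simp: module_hom_iff)
  have "h (q + r) t = h q t + h r t" for q r t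
    by (induct t rule: tensor_basis_induct) (simp_all add: h_basis h_add gE)
  moreover have "h (scaleQ c q) t = scaleP c (h q t)" for c q t
    by (induct t rule: tensor_basis_induct)
      (simp_all add: h_basis h_add gE P.scale_right_distrib)
  ultimately have "bilinear_map scaleT scaleQ scaleP (\<lambda>t q. h q t)"
    unfolding bilinear_map_iff
    by (intro conjI allI T.module_axioms Q.module_axioms P.module_axioms)
      (simp_all add: h_add h_scale)
  then show "\<exists>h. bilinear_map scaleT scaleQ scaleP h \<and>
      (\<forall>a x q. h (tensor a (free_basis x)) q = g x a q)"
    using h_basis by blast
next
  fix h h'
  assume h: "bilinear_map scaleT scaleQ scaleP h \<and>
      (\<forall>a x q. h (tensor a (free_basis x)) q = g x a q)"
    and h': "bilinear_map scaleT scaleQ scaleP h' \<and>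
      (\<forall>a x q. h' (tensor a (free_basis x)) q = g x a q)"
  have "h t q = h' t q" for t q
    by (induct t rule: tensor_basis_induct) (use h h' in \<open>simp_all add: bilinear_map_iff\<close>)
  then show "h = h'" by blast
qed

end

section \<open>The algebra and its bimodule\<close>

locale dendriform_tensor =
  matching_dendriform_algebra scaleD prec succ + tensor_with_free scaleD scaleT tensor
  for scaleD :: "'k::comm_ring_1 \<Rightarrow> 'd::ab_group_add \<Rightarrow> 'd"
    and prec succ :: "'x \<Rightarrow> 'd \<Rightarrow> 'd \<Rightarrow> 'd"
    and scaleT :: "'k \<Rightarrow> 't::ab_group_add \<Rightarrow> 't"
    and tensor :: "'d \<Rightarrow> ('x \<Rightarrow>\<^sub>0 'k) \<Rightarrow> 't"
begin

lemma
  shows prec_add_left: "prec x (a + b) c = prec x a c + prec x b c"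
    and prec_scale_left: "prec x (scaleD k a) c = scaleD k (prec x a c)"
    and prec_add_right: "prec x a (b + c) = prec x a b + prec x a c"
    and prec_scale_right: "prec x a (scaleD k b) = scaleD k (prec x a b)"
  using prec_bilinear[of x] unfolding bilinear_map_iff by blast+

lemma
  shows succ_add_left: "succ x (a + b) c = succ x a c + succ x b c"
    and succ_scale_left: "succ x (scaleD k a) c = scaleD k (succ x a c)"
    and succ_add_right: "succ x a (b + c) = succ x a b + succ x a c"
    and succ_scale_right: "succ x a (scaleD k b) = scaleD k (succ x a b)"
  using succ_bilinear[of x] unfolding bilinear_map_iff by blast+

lemma ex1_lact: "\<exists>!lact. is_dendriform_lact scaleD scaleT tensor succ lact"
proof -
  have "is_dendriform_lact scaleD scaleT tensor succ = (\<lambda>h. bilinear_map scaleT scaleD scaleD h \<and>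
      (\<forall>a x q. h (tensor a (free_basis x)) q = succ x a q))"
    by (auto simp: is_dendriform_lact_def fun_eq_iff)
  then show ?thesis
    using bilinear_extension[OF succ_bilinear] by simp
qed

lemma ex1_ract: "\<exists>!ract. is_dendriform_ract scaleD scaleT tensor prec ract"
proof -
  have flip: "is_dendriform_ract scaleD scaleT tensor prec r \<longleftrightarrow>
      bilinear_map scaleT scaleD scaleD (\<lambda>t b. r b t) \<and>
      (\<forall>a x q. (\<lambda>t b. r b t) (tensor a (free_basis x)) q = (\<lambda>a b. prec x b a) a q)" for r
    using bilinear_map_flip[of scaleD scaleT scaleD r]
      bilinear_map_flip[of scaleT scaleD scaleD "\<lambda>t b. r b t"]
    by (auto simp: is_dendriform_ract_def)
  obtain h where h: "bilinear_map scaleT scaleD scaleD h \<and>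
      (\<forall>a x q. h (tensor a (free_basis x)) q = (\<lambda>a b. prec x b a) a q)"
    and unique: "\<And>h'. bilinear_map scaleT scaleD scaleD h' \<and>
      (\<forall>a x q. h' (tensor a (free_basis x)) q = (\<lambda>a b. prec x b a) a q) \<Longrightarrow> h' = h"
    using bilinear_extension[where g = "\<lambda>x a b. prec x b a", OF bilinear_map_flip[OF prec_bilinear]]
    by (elim ex1E) blast
  show ?thesis
  proof (rule ex1I[of _ "\<lambda>b t. h t b"])
    show "is_dendriform_ract scaleD scaleT tensor prec (\<lambda>b t. h t b)"
      using h by (simp add: flip)
    show "r = (\<lambda>b t. h t b)" if "is_dendriform_ract scaleD scaleT tensor prec r" for r
      using unique[OF that[unfolded flip]] by (simp add: fun_eq_iff)
  qed
qed

text \<open>The multiplication is extended one factor at a time: first in \<open>b \<otimes> y\<close>, with \<open>x\<close> fixed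
  and \<open>a\<close> as parameter, and then in \<open>a \<otimes> x\<close>, with the whole second factor as
  parameter.\<close>

lemma ex1_mult: "\<exists>!mul. is_dendriform_mult scaleT tensor prec succ mul"
proof (rule ex_ex1I)
  let ?v = "\<lambda>x y b a. tensor (prec y a b) (free_basis x) + tensor (succ x a b) (free_basis y)"
  have "bilinear_map scaleD scaleD scaleT (?v x y)" for x y
    unfolding bilinear_map_iff
    by (intro conjI allI module_axioms T.module_axioms)
      (simp_all add: prec_add_left prec_scale_left prec_add_right prec_scale_right
        succ_add_left succ_scale_left succ_add_right succ_scale_right
        tensor_add_left tensor_scale_left T.scale_right_distrib)
  then have "\<exists>h. bilinear_map scaleT scaleD scaleT h \<and>
      (\<forall>b y a. h (tensor b (free_basis y)) a = ?v x y b a)" for x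
    using bilinear_extension[of scaleD scaleT "?v x"] by blast
  then obtain h where h: "\<And>x. bilinear_map scaleT scaleD scaleT (h x)"
    and h_basis: "\<And>x y a b. h x (tensor b (free_basis y)) a = ?v x y b a"
    by metis
  obtain m where "bilinear_map scaleT scaleT scaleT m"
    and "\<And>a x t. m (tensor a (free_basis x)) t = h x t a"
    using bilinear_extension[where g = "\<lambda>x a t. h x t a", OF bilinear_map_flip[OF h]]
    by (elim ex1E) blast
  then show "\<exists>mul. is_dendriform_mult scaleT tensor prec succ mul"
    using h_basis by (auto simp: is_dendriform_mult_def)
next
  fix m m'
  assume m: "is_dendriform_mult scaleT tensor prec succ m"
    and m': "is_dendriform_mult scaleT tensor prec succ m'"
  have "m s t = m' s t" for s t
  proof (induct s rule: tensor_basis_induct)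
    case (basis a x)
    show ?case
      by (induct t rule: tensor_basis_induct)
        (use m m' in \<open>simp_all add: is_dendriform_mult_def bilinear_map_iff\<close>)
  next
    case (add s s')
    then show ?case using m m' by (simp add: is_dendriform_mult_def bilinear_map_iff)
  qed
  then show "m = m'" by blast
qed

context
  fixes mul lact ract
  assumes mult: "is_dendriform_mult scaleT tensor prec succ mul"
    and lact: "is_dendriform_lact scaleD scaleT tensor succ lact"
    and ract: "is_dendriform_ract scaleD scaleT tensor prec ract"
begin

lemma mul_basis: "mul (tensor a (free_basis x)) (tensor b (free_basis y)) =
    tensor (prec y a b) (free_basis x) + tensor (succ x a b) (free_basis y)"
  and mul_add_left: "mul (s + s') t = mul s t + mul s' t"
  and mul_add_right: "mul s (t + t') = mul s t + mul s t'"
  using mult unfolding is_dendriform_mult_def bilinear_map_iff by blast+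

lemma lact_basis: "lact (tensor a (free_basis x)) b = succ x a b"
  and lact_add_left: "lact (s + s') b = lact s b + lact s' b"
  and lact_add_right: "lact s (b + b') = lact s b + lact s b'"
  using lact unfolding is_dendriform_lact_def bilinear_map_iff by blast+

lemma ract_basis: "ract b (tensor a (free_basis x)) = prec x b a"
  and ract_add_left: "ract (b + b') s = ract b s + ract b' s"
  and ract_add_right: "ract b (s + s') = ract b s + ract b s'"
  using ract unfolding is_dendriform_ract_def bilinear_map_iff by blast+

lemma dendriform_mult_assoc: "mul (mul r s) t = mul r (mul s t)"
proof (induct r rule: tensor_basis_induct)
  case (basis a x)
  show ?case
  proof (induct s rule: tensor_basis_induct)
    case (basis b y)
    show ?case
    proof (induct t rule: tensor_basis_induct)
      case (basis c z)
      show ?case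
        by (simp add: mul_basis mul_add_left mul_add_right prec_prec succ_prec
            succ_succ[symmetric] tensor_add_left add_ac)
    qed (simp add: mul_add_right)
  qed (simp add: mul_add_left mul_add_right)
qed (simp add: mul_add_left)

lemma dendriform_lact_lact: "lact s (lact t u) = lact (mul s t) u"
proof (induct s rule: tensor_basis_induct)
  case (basis a x)
  show ?case
    by (induct t rule: tensor_basis_induct)
      (simp_all add: mul_basis mul_add_right lact_basis lact_add_left lact_add_right succ_succ
        succ_add_right)
qed (simp add: mul_add_left lact_add_left)

lemma dendriform_ract_ract: "ract (ract u s) t = ract u (mul s t)"
proof (induct s rule: tensor_basis_induct)
  case (basis a x)
  show ?case
    by (induct t rule: tensor_basis_induct)
      (simp_all add: mul_basis mul_add_right ract_basis ract_add_right prec_prec)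
qed (simp add: mul_add_left ract_add_left ract_add_right)

lemma dendriform_lact_ract: "ract (lact s u) t = lact s (ract u t)"
proof (induct s rule: tensor_basis_induct)
  case (basis a x)
  show ?case
    by (induct t rule: tensor_basis_induct)
      (simp_all add: lact_basis ract_basis ract_add_right succ_add_right succ_prec)
qed (simp add: lact_add_left ract_add_left)

lemma dendriform_rota_baxter:
  "matching_relative_rota_baxter_algebra scaleT mul scaleD lact ract (basis_embedding tensor)"
proof (intro matching_relative_rota_baxter_algebra.intro algebra_bimodule.intro
    associative_algebra.intro matching_relative_rota_baxter_algebra_axioms.intro
    algebra_bimodule_axioms.intro associative_algebra_axioms.intro)
  show "bilinear_map scaleT scaleT scaleT mul"
    using mult by (simp add: is_dendriform_mult_def)
  show "bilinear_map scaleT scaleD scaleD lact"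
    using lact by (simp add: is_dendriform_lact_def)
  show "bilinear_map scaleD scaleT scaleD ract"
    using ract by (simp add: is_dendriform_ract_def)
  show "module_hom scaleD scaleT (basis_embedding tensor x)" for x
    using bilinear_tensor by (simp add: basis_embedding_def[abs_def] bilinear_map_def)
  show "mul (basis_embedding tensor x u) (basis_embedding tensor y v) =
      basis_embedding tensor x (ract u (basis_embedding tensor y v)) +
      basis_embedding tensor y (lact (basis_embedding tensor x u) v)" for x y u v
    by (simp add: basis_embedding_def mul_basis lact_basis ract_basis)
qed (rule module_axioms T.module_axioms dendriform_mult_assoc
    dendriform_lact_lact dendriform_ract_ract dendriform_lact_ract)+

lemma induced_prec_eq: "induced_prec ract (basis_embedding tensor) = prec"
  by (intro ext) (simp add: induced_prec_def basis_embedding_def ract_basis)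

lemma induced_succ_eq: "induced_succ lact (basis_embedding tensor) = succ"
  by (intro ext) (simp add: induced_succ_def basis_embedding_def lact_basis)

end

end

theorem mainTheorem8:
  fixes scaleD :: "'k::comm_ring_1 \<Rightarrow> 'd::ab_group_add \<Rightarrow> 'd"
    and prec succ :: "'x \<Rightarrow> 'd \<Rightarrow> 'd \<Rightarrow> 'd"
    and scaleT :: "'k \<Rightarrow> 't::ab_group_add \<Rightarrow> 't"
    and tensor :: "'d \<Rightarrow> ('x \<Rightarrow>\<^sub>0 'k) \<Rightarrow> 't"
  assumes "CHAR('k) \<noteq> 2"
    and "matching_dendriform_algebra scaleD prec succ"
    and "tensor_product scaleD free_scale scaleT tensor"
  shows "(\<exists>!mul. is_dendriform_mult scaleT tensor prec succ mul) \<and>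
    (\<exists>!lact. is_dendriform_lact scaleD scaleT tensor succ lact) \<and>
    (\<exists>!ract. is_dendriform_ract scaleD scaleT tensor prec ract) \<and>
    (\<forall>mul lact ract.
      is_dendriform_mult scaleT tensor prec succ mul \<longrightarrow>
      is_dendriform_lact scaleD scaleT tensor succ lact \<longrightarrow>
      is_dendriform_ract scaleD scaleT tensor prec ract \<longrightarrow>
      matching_relative_rota_baxter_algebra scaleT mul scaleD lact ract
        (basis_embedding tensor) \<and>
      induced_prec ract (basis_embedding tensor) = prec \<and>
      induced_succ lact (basis_embedding tensor) = succ)"
proof -
  interpret dendriform_tensor scaleD prec succ scaleT tensor
    using assms(2,3) by (intro dendriform_tensor.intro tensor_with_free.intro)
  show ?thesis
    by (intro conjI allI impI ex1_mult ex1_lact ex1_ract dendriform_rota_baxter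
        induced_prec_eq induced_succ_eq)
qed

end
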